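(* Let $K$ be a field of characteristic $\ne 2,3$, let $n\ge5$, and let $S\in\mathrm{GL}_n(K)$ be the symmetric matrix defining the split special orthogonal group $\mathrm{SO}_n$ over $K$. Let $f$ be the polynomial function $f(X)=\det(XSX^t)$ of degree $4$ on the space of $2\times n$ matrices over $K$. Every linear transformation of the space of $2\times n$ matrices over $K$ that preserves $f$ is of the form $$X\mapsto g_1Xg_2^t\quad\text{for some } g_1\in\mathrm{GL}_2(K),\ g_2\in\mathrm{GO}_n(K)\text{ with }\det(g_1)\mu(g_2)=\pm1.$$
   Context: $S$ is the Gram matrix of a nondegenerate symmetric bilinear form of maximal Witt index on $K^n$, with $\mathrm{SO}_n(K)=\{g\in\mathrm{SL}_n(K): g^tSg=S\}$. $\mathrm{GO}_n$ is the algebraic group whose $R$-points, for every commutative $K$-algebra $R$, are the matrices $g\in\mathrm{GL}_n(R)$ such that $g^tSg=\mu(g)S$ for some $\mu(g)\in R^\times$. A linear transformation $\phi$ preserves $f$ if $f\circ\phi=f$ as polynomials. *)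

theory Defs
  imports "HOL-Analysis.Analysis" "HOL-Library.Poly_Mapping"
begin

definition mat_scale :: "'a::times \<Rightarrow> 'a^'n^'m \<Rightarrow> 'a^'n^'m"
  where "mat_scale c A = map_matrix ((*) c) A"

lemma vector_space_mat_scale: "vector_space (mat_scale :: 'k::field \<Rightarrow> 'k^'n^'m \<Rightarrow> 'k^'n^'m)"
  by unfold_locales (simp_all add: mat_scale_def map_matrix_def vec_eq_iff algebra_simps)

section \<open>Split symmetric bilinear forms and their similitudes\<close>

text \<open>The form \<open>x\<^sup>t S y\<close> on column vectors.\<close>

definition gram_form :: "'k::comm_ring_1^'n^'n \<Rightarrow> 'k^'n \<Rightarrow> 'k^'n \<Rightarrow> 'k"
  where "gram_form S x y = (\<Sum>i\<in>UNIV. x $ i * (S *v y) $ i)"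

definition totally_isotropic :: "'k::field^'n^'n \<Rightarrow> ('k^'n) set \<Rightarrow> bool"
  where "totally_isotropic S W \<longleftrightarrow> (\<forall>x\<in>W. \<forall>y\<in>W. gram_form S x y = 0)"

definition witt_index :: "'k::field^'n^'n \<Rightarrow> nat"
  where "witt_index S = Max {vec.dim W | W. vec.subspace W \<and> totally_isotropic S W}"

lemma finite_witt_index_dims:
  fixes S :: "'k::field^'n^'n"
  shows "finite {vec.dim W | W. vec.subspace W \<and> totally_isotropic S W}"
proof (rule finite_subset)
  show "{vec.dim W | W. vec.subspace W \<and> totally_isotropic S W} \<subseteq> {..CARD('n)}"
    using vec.dim_subset_UNIV[where ?'a = 'k and ?'b = 'n]
    by (auto simp: vec.dimension_def card_cart_basis)
qed simp

text \<open>A nondegenerate form on \<open>K\<^sup>n\<close> has Witt index at most \<open>\<lfloor>n/2\<rfloor>\<close>; the split forms are those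
  attaining this bound.\<close>

definition split_gram_matrix :: "'k::field^'n^'n \<Rightarrow> bool"
  where "split_gram_matrix S \<longleftrightarrow>
    transpose S = S \<and> invertible S \<and> witt_index S = CARD('n) div 2"

text \<open>For a commutative \<open>K\<close>-algebra \<open>R\<close>, the group \<open>GO\<^sub>n(R)\<close> is \<open>GO S\<close> with the
  entries of \<open>S\<close> read in \<open>R\<close>.\<close>

definition GO :: "'r::comm_ring_1^'n^'n \<Rightarrow> ('r^'n^'n) set"
  where "GO S = {g. invertible g \<and> (\<exists>c. c dvd 1 \<and> transpose g ** S ** g = mat_scale c S)}"

definition multiplier :: "'r::comm_ring_1^'n^'n \<Rightarrow> 'r^'n^'n \<Rightarrow> 'r"
  where "multiplier S g = (THE c. c dvd 1 \<and> transpose g ** S ** g = mat_scale c S)"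

lemma multiplier_eqI:
  fixes S g :: "'k::field^'n^'n"
  assumes "invertible S" "c \<noteq> 0" "transpose g ** S ** g = mat_scale c S"
  shows "multiplier S g = c"
proof -
  have "S \<noteq> 0"
  proof
    assume "S = 0"
    then have "(0 :: 'k^'n^'n) = mat 1"
      using assms(1) by (auto simp: invertible_def)
    then show False
      by (auto simp: vec_eq_iff mat_def split: if_splits)
  qed
  then obtain i j where "S $ i $ j \<noteq> 0"
    by (auto simp: vec_eq_iff)
  then have "d = c" if "mat_scale c S = mat_scale d S" for d
    using that by (auto simp: mat_scale_def vec_eq_iff map_matrix_def)
  with assms(2,3) show ?thesis
    unfolding multiplier_def by (intro the_equality) (auto simp: dvd_field_iff)
qed

section \<open>Polynomials in the entries of a matrix\<close>

text \<open>\<open>('a, 'v) mpoly\<close> is the polynomial ring over \<open>'a\<close> in indeterminates indexed by \<open>'v\<close>: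
  finitely supported coefficient functions on the exponent vectors, with the convolution product
  of \<^theory>\<open>HOL-Library.Poly_Mapping\<close>. Over a finite field this is not the same as polynomial
  functions.\<close>

type_synonym ('a, 'v) mpoly = "('v \<Rightarrow>\<^sub>0 nat) \<Rightarrow>\<^sub>0 'a"

definition mconst :: "'a::comm_ring_1 \<Rightarrow> ('a, 'v) mpoly"
  where "mconst c = Poly_Mapping.single 0 c"

definition mvar :: "'v \<Rightarrow> ('a::comm_ring_1, 'v) mpoly"
  where "mvar v = Poly_Mapping.single (Poly_Mapping.single v 1) 1"

definition msubst :: "('v \<Rightarrow> ('a::comm_ring_1, 'w) mpoly) \<Rightarrow> ('a, 'v) mpoly \<Rightarrow> ('a, 'w) mpoly"
  where "msubst \<sigma> p =
    (\<Sum>m\<in>Poly_Mapping.keys p. mconst (Poly_Mapping.lookup p m) *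
       (\<Prod>v\<in>Poly_Mapping.keys m. \<sigma> v ^ Poly_Mapping.lookup m v))"

text \<open>The indeterminate \<open>mvar (i, j)\<close> is the coordinate function \<open>X \<mapsto> X\<^sub>i\<^sub>j\<close>.\<close>

definition generic_matrix :: "('a::comm_ring_1, 'm \<times> 'n) mpoly^'n^'m"
  where "generic_matrix = (\<chi> i j. mvar (i, j))"

definition matrix_unit :: "'m \<Rightarrow> 'n \<Rightarrow> 'a::comm_ring_1^'n^'m"
  where "matrix_unit k l = (\<chi> i j. if i = k \<and> j = l then 1 else 0)"

text \<open>For linear \<open>\<phi>\<close>, the coordinate function \<open>X \<mapsto> \<phi>(X)\<^sub>i\<^sub>j\<close> as a linear form.\<close>

definition coordinate_form ::
    "('a::comm_ring_1^'n^'m \<Rightarrow> 'a^'n^'m) \<Rightarrow> 'm \<times> 'n \<Rightarrow> ('a, 'm \<times> 'n) mpoly"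
  where "coordinate_form \<phi> = (\<lambda>(i, j).
    \<Sum>k\<in>UNIV. \<Sum>l\<in>UNIV. mconst (\<phi> (matrix_unit k l) $ i $ j) * mvar (k, l))"

definition preserves_poly ::
    "('a::comm_ring_1^'n^'m \<Rightarrow> 'a^'n^'m) \<Rightarrow> ('a, 'm \<times> 'n) mpoly \<Rightarrow> bool"
  where "preserves_poly \<phi> f \<longleftrightarrow> msubst (coordinate_form \<phi>) f = f"

definition gram_det_poly :: "'a::comm_ring_1^'n^'n \<Rightarrow> ('a, 2 \<times> 'n) mpoly"
  where "gram_det_poly S =
    det (generic_matrix ** map_matrix mconst S ** transpose generic_matrix)"

end

theory Submission
  imports Defs
begin

text \<open>Write \<open>f(x, y) = q(x) q(y) - b(x, y)\<^sup>2\<close> for the rows \<open>x\<close>, \<open>y\<close>. As \<open>2\<close> and \<open>3\<close> are invertible, the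
  preserver \<open>\<phi>\<close> also preserves the gradient and the Hessian of \<open>f\<close>. The Hessian shows that \<open>\<phi>\<close> is
  injective. The singular points of \<open>f\<close> are the matrices of rank at most one and those whose rows span
  a totally isotropic plane; the rank of the Hessian separates the two kinds when \<open>n \<ge> 5\<close>, so \<open>\<phi>\<close>
  preserves rank at most one. A space of rank-one matrices of dimension at least 3 consists
  of the \<open>p \<otimes> w\<close> with \<open>p\<close> fixed, which gives \<open>\<phi>(X) = g\<^sub>1 X g\<^sub>2\<^sup>t\<close>. Finally, \<open>f\<close> determines \<open>q\<close> up to a
  scalar, so \<open>g\<^sub>2\<close> is a similitude.\<close>

section \<open>Evaluation of polynomials\<close>

text \<open>The product runs over all indeterminates, so that exponents of monomials add under
  multiplication without a change of index set.\<close>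

definition meval :: "('v::finite \<Rightarrow> 'a) \<Rightarrow> ('a::comm_ring_1, 'v) mpoly \<Rightarrow> 'a"
  where "meval x p = (\<Sum>m\<in>Poly_Mapping.keys p. Poly_Mapping.lookup p m *
    (\<Prod>v\<in>UNIV. x v ^ Poly_Mapping.lookup m v))"

lemma meval_superset:
  assumes "finite M" "Poly_Mapping.keys p \<subseteq> M"
  shows "meval x p = (\<Sum>m\<in>M. Poly_Mapping.lookup p m *
    (\<Prod>v\<in>UNIV. x v ^ Poly_Mapping.lookup m v))"
  unfolding meval_def
  by (rule sum.mono_neutral_left) (use assms in \<open>auto simp: in_keys_iff\<close>)

lemma meval_0 [simp]: "meval x 0 = 0"
  by (simp add: meval_def)

lemma meval_add: "meval x (p + q) = meval x p + meval x q"
proof -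
  let ?M = "Poly_Mapping.keys p \<union> Poly_Mapping.keys q"
  have "Poly_Mapping.keys (p + q) \<subseteq> ?M"
    by (rule keys_add)
  then show ?thesis
    unfolding meval_superset[OF _ \<open>Poly_Mapping.keys (p + q) \<subseteq> ?M\<close>, of x, simplified]
    by (simp add: meval_superset[of ?M p] meval_superset[of ?M q] lookup_add distrib_right sum.distrib)
qed

lemma meval_single:
  "meval x (Poly_Mapping.single m c) = c * (\<Prod>v\<in>UNIV. x v ^ Poly_Mapping.lookup m v)"
  by (subst meval_superset[of "{m}"]) auto

lemma meval_mconst [simp]: "meval x (mconst c) = c"
  by (simp add: mconst_def meval_single)

lemma meval_mvar [simp]: "meval x (mvar v) = x v"
proof -
  have "(\<Prod>w\<in>UNIV. x w ^ Poly_Mapping.lookup (Poly_Mapping.single v 1) w)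
      = (\<Prod>w\<in>UNIV. if w = v then x w else 1)"
    by (rule prod.cong) (auto simp: lookup_single when_def)
  then show ?thesis
    by (simp add: mvar_def meval_single)
qed

lemma meval_sum: "meval x (\<Sum>i\<in>I. p i) = (\<Sum>i\<in>I. meval x (p i))"
  by (induction I rule: infinite_finite_induct) (simp_all add: meval_add)

lemma meval_diff: "meval x (p - q) = meval x p - meval x q"
  using meval_add[of x "p - q" q] by simp

lemma sum_monomials:
  "(\<Sum>m\<in>Poly_Mapping.keys p. Poly_Mapping.single m (Poly_Mapping.lookup p m)) = p"
proof (rule poly_mapping_eqI)
  fix k
  show "Poly_Mapping.lookup (\<Sum>m\<in>Poly_Mapping.keys p. Poly_Mapping.single m (Poly_Mapping.lookup p m)) k
      = Poly_Mapping.lookup p k"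
    by (auto simp: lookup_sum lookup_single when_def in_keys_iff)
qed

lemma meval_mult: "meval x (p * q) = meval x p * meval x q"
proof -
  let ?c = Poly_Mapping.lookup
  let ?s = "Poly_Mapping.single"
  have "p * q = (\<Sum>m\<in>Poly_Mapping.keys p. \<Sum>l\<in>Poly_Mapping.keys q.
      ?s m (?c p m) * ?s l (?c q l))"
    by (simp only: sum_product[symmetric] sum_monomials)
  then have "meval x (p * q) = (\<Sum>m\<in>Poly_Mapping.keys p. \<Sum>l\<in>Poly_Mapping.keys q.
      meval x (?s m (?c p m)) * meval x (?s l (?c q l)))"
    by (simp add: meval_sum mult_single meval_single lookup_add power_add prod.distrib ac_simps)
  also have "\<dots> = meval x p * meval x q"
    unfolding meval_single by (simp only: meval_def sum_product)
  finally show ?thesis .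
qed

lemma mconst_1: "mconst 1 = 1"
  by (simp add: mconst_def)

lemma meval_1 [simp]: "meval x 1 = 1"
  using meval_mconst[of x 1] by (simp add: mconst_1)

lemma meval_power: "meval x (p ^ k) = meval x p ^ k"
  by (induction k) (simp_all add: meval_mult)

lemma meval_prod: "meval x (\<Prod>i\<in>I. p i) = (\<Prod>i\<in>I. meval x (p i))"
  by (induction I rule: infinite_finite_induct) (simp_all add: meval_mult)

lemma meval_msubst:
  fixes \<sigma> :: "'v::finite \<Rightarrow> ('a::comm_ring_1, 'w::finite) mpoly"
  shows "meval x (msubst \<sigma> p) = meval (\<lambda>v. meval x (\<sigma> v)) p"
proof -
  \<comment> \<open>Substitution multiplies over the support of a monomial, evaluation over all
    indeterminates; the extra factors are zeroth powers.\<close>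
  have *: "(\<Prod>v\<in>Poly_Mapping.keys m. y v ^ Poly_Mapping.lookup m v)
      = (\<Prod>v\<in>UNIV. y v ^ Poly_Mapping.lookup m v)" for y :: "'v \<Rightarrow> 'a" and m
    by (rule prod.mono_neutral_left) (auto simp: in_keys_iff)
  show ?thesis
    unfolding msubst_def meval_sum meval_mult meval_prod meval_power meval_mconst *
    by (simp only: meval_def)
qed

section \<open>The quartic f as a function on matrices\<close>

definition gram_det :: "'k::comm_ring_1^'n^'n \<Rightarrow> 'k^'n^2 \<Rightarrow> 'k"
  where "gram_det S X = gram_form S (X $ 1) (X $ 1) * gram_form S (X $ 2) (X $ 2)
    - gram_form S (X $ 1) (X $ 2) * gram_form S (X $ 2) (X $ 1)"

lemma meval_gram_det_poly:
  "meval (\<lambda>(i, j). X $ i $ j) (gram_det_poly S) = gram_det S X"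
proof -
  let ?G = "generic_matrix :: ('a, 2 \<times> 'n) mpoly^'n^2"
  have "meval (\<lambda>(i, j). X $ i $ j)
      ((?G ** map_matrix mconst S ** transpose ?G) $ i $ j) = gram_form S (X $ i) (X $ j)" for i j
  proof -
    have "meval (\<lambda>(i, j). X $ i $ j)
      ((?G ** map_matrix mconst S ** transpose ?G) $ i $ j)
      = (\<Sum>k\<in>UNIV. \<Sum>l\<in>UNIV. X $ i $ l * S $ l $ k * X $ j $ k)"
      by (simp add: matrix_matrix_mult_def transpose_def generic_matrix_def map_matrix_def
          meval_sum meval_mult sum_distrib_right)
    also have "\<dots> = (\<Sum>l\<in>UNIV. \<Sum>k\<in>UNIV. X $ i $ l * S $ l $ k * X $ j $ k)"
      by (rule sum.swap)
    finally show ?thesis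
      by (simp add: gram_form_def matrix_vector_mult_def sum_distrib_left ac_simps)
  qed
  then show ?thesis
    by (simp add: gram_det_poly_def det_2 meval_diff meval_mult gram_det_def)
qed

lemma matrix_unit_decomposition:
  "X = (\<Sum>k\<in>UNIV. \<Sum>l\<in>UNIV. mat_scale (X $ k $ l) (matrix_unit k l))"
proof -
  have *: "(\<Sum>l\<in>UNIV. X $ k $ l * (if i = k \<and> j = l then 1 else 0)) = (if i = k then X $ k $ j else 0)"
    for i j k
    by (cases "i = k") (simp_all add: if_distrib[of "(*) _"] cong: if_cong)
  show ?thesis
    unfolding vec_eq_iff by (simp add: mat_scale_def map_matrix_def matrix_unit_def *)
qed

lemma meval_coordinate_form:
  fixes \<phi> :: "'k::field^'n^'m \<Rightarrow> 'k^'n^'m"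
  assumes "Vector_Spaces.linear mat_scale mat_scale \<phi>"
  shows "meval (\<lambda>(i, j). X $ i $ j) (coordinate_form \<phi> p) = (case p of (i, j) \<Rightarrow> \<phi> X $ i $ j)"
proof (cases p)
  case (Pair i j)
  interpret Vector_Spaces.linear mat_scale mat_scale \<phi> by fact
  have "\<phi> X = \<phi> (\<Sum>k\<in>UNIV. \<Sum>l\<in>UNIV. mat_scale (X $ k $ l) (matrix_unit k l))"
    by (rule arg_cong[OF matrix_unit_decomposition])
  also have "\<dots> = (\<Sum>k\<in>UNIV. \<Sum>l\<in>UNIV. mat_scale (X $ k $ l) (\<phi> (matrix_unit k l)))"
    by (simp only: sum scale)
  finally have "\<phi> X $ i $ j = (\<Sum>k\<in>UNIV. \<Sum>l\<in>UNIV. X $ k $ l * \<phi> (matrix_unit k l) $ i $ j)"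
    by (simp add: mat_scale_def map_matrix_def)
  also have "\<dots> = (\<Sum>k\<in>UNIV. \<Sum>l\<in>UNIV. \<phi> (matrix_unit k l) $ i $ j * X $ k $ l)"
    by (simp only: mult.commute)
  finally show ?thesis
    by (simp add: Pair coordinate_form_def meval_sum meval_mult)
qed

text \<open>This passes from an identity of polynomials to one of values, the form in which the
  preservation is used from here on.\<close>

lemma gram_det_preserved:
  fixes \<phi> :: "'k::field^'n^2 \<Rightarrow> 'k^'n^2"
  assumes "Vector_Spaces.linear mat_scale mat_scale \<phi>"
    and "preserves_poly \<phi> (gram_det_poly S)"
  shows "gram_det S (\<phi> X) = gram_det S X"
proof -
  have "gram_det S X = meval (\<lambda>(i, j). X $ i $ j)
      (msubst (coordinate_form \<phi>) (gram_det_poly S))"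
    using assms(2) by (simp add: preserves_poly_def meval_gram_det_poly)
  also have "\<dots> = meval (\<lambda>(i, j). \<phi> X $ i $ j) (gram_det_poly S)"
    by (simp add: meval_msubst meval_coordinate_form[OF assms(1)])
  finally show ?thesis
    by (simp add: meval_gram_det_poly)
qed

section \<open>Linear algebra\<close>

lemma linear_functional_iff:
  "Vector_Spaces.linear (*s) (*) (f :: 'k::field^'n \<Rightarrow> 'k) \<longleftrightarrow>
    (\<forall>x y. f (x + y) = f x + f y) \<and> (\<forall>c x. f (c *s x) = c * f x)"
  by (simp add: Vector_Spaces.linear_iff vec.vector_space_axioms
      vector_space_over_itself.vector_space_axioms)

lemma linear_vec_iff:
  "Vector_Spaces.linear (*s) (*s) (f :: 'k::field^'n \<Rightarrow> 'k^'m) \<longleftrightarrow>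
    (\<forall>x y. f (x + y) = f x + f y) \<and> (\<forall>c x. f (c *s x) = c *s f x)"
  by (simp add: Vector_Spaces.linear_iff vec.vector_space_axioms)

lemma common_zero:
  fixes L :: "('k::field^'n \<Rightarrow> 'k) list"
  assumes lin: "\<And>f. f \<in> set L \<Longrightarrow> Vector_Spaces.linear (*s) (*) f"
    and len: "length L < CARD('n)"
  obtains w where "w \<noteq> 0" "\<And>f. f \<in> set L \<Longrightarrow> f w = 0"
proof -
  obtain h where h: "bij_betw h {0..<CARD('n)} (UNIV :: 'n set)"
    using ex_bij_betw_nat_finite[of "UNIV :: 'n set"] by auto
  define idx where "idx = the_inv_into {0..<CARD('n)} h"
  have idx: "idx (h k) = k" if "k < CARD('n)" for k
    unfolding idx_def using h that by (auto simp: bij_betw_def intro: the_inv_into_f_f)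
  \<comment> \<open>The functionals fill the first rows of a square matrix and the other rows are
    zero. There is at least one zero row, so the matrix is singular, and a kernel vector is a common
    zero.\<close>
  define A :: "'k^'n^'n"
    where "A = (\<chi> i j. if idx i < length L then (L ! idx i) (axis j 1) else 0)"
  have "row (h (length L)) A = 0"
    using len by (simp add: row_def A_def idx vec_eq_iff)
  then have "\<not> invertible A"
    using det_zero_row(2) invertible_det_nz by blast
  then obtain w where w: "A *v w = 0" "w \<noteq> 0"
    unfolding invertible_left_inverse matrix_left_invertible_ker by blast
  have "f w = 0" if f: "f \<in> set L" for f
  proof -
    obtain k where k: "k < length L" "f = L ! k"
      using f by (auto simp: in_set_conv_nth)
    interpret f: Vector_Spaces.linear "(*s)" "(*)" f
      using lin f .
    have "f w = f (\<Sum>j\<in>UNIV. w $ j *s axis j 1)"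
      by (simp add: basis_expansion)
    also have "\<dots> = (\<Sum>j\<in>UNIV. f (axis j 1) * w $ j)"
      by (simp add: f.sum f.scale mult.commute)
    also have "\<dots> = (A *v w) $ h k"
      using k len by (simp add: A_def matrix_vector_mult_def idx)
    finally show ?thesis
      using w by simp
  qed
  with w that show thesis by blast
qed

text \<open>Vanishing minors, rather than a proportionality factor, make the relation symmetric and
  include zero vectors.\<close>

definition parallel :: "'k::field^'n \<Rightarrow> 'k^'n \<Rightarrow> bool"
  where "parallel x y \<longleftrightarrow> (\<forall>i j. x $ i * y $ j = x $ j * y $ i)"

lemma parallel_sym: "parallel x y \<longleftrightarrow> parallel y x"
  unfolding parallel_def by (metis mult.commute)

lemma parallel_multiple:
  assumes "parallel x y" "x \<noteq> 0"
  obtains c where "y = c *s x"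
proof -
  obtain i where "x $ i \<noteq> 0"
    using assms(2) by (auto simp: vec_eq_iff)
  then have "y = (y $ i / x $ i) *s x"
    using assms(1) by (auto simp: vec_eq_iff parallel_def field_simps)
  with that show thesis .
qed

lemma parallel_diff_scale: "parallel x y \<Longrightarrow> parallel x (y - c *s x)"
  by (simp add: parallel_def algebra_simps)

text \<open>A linear space of matrices of rank at most one with rows \<open>A v\<close>,
  \<open>B v\<close> has either a common column direction (p1, p2) or a common row direction u. The
  second case allows dimension at most 2, which the trivial common kernel and
  \<open>CARD('n) \<ge> 3\<close> exclude.\<close>

lemma parallel_pencil:
  fixes A B :: "'k::field^'n \<Rightarrow> 'k^'m"
  assumes A: "Vector_Spaces.linear (*s) (*s) A" and B: "Vector_Spaces.linear (*s) (*s) B"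
    and par: "\<And>v. parallel (A v) (B v)"
    and ker: "\<And>v. A v = 0 \<Longrightarrow> B v = 0 \<Longrightarrow> v = 0"
    and n: "CARD('n) \<ge> 3"
  obtains p1 p2 and G :: "'k^'n \<Rightarrow> 'k^'m"
  where "Vector_Spaces.linear (*s) (*s) G" "\<And>v. A v = p1 *s G v" "\<And>v. B v = p2 *s G v"
proof (cases "\<forall>v. A v = 0")
  case True
  then show thesis
    using that[of B 0 1] B by simp
next
  case False
  then obtain v1 where v1: "A v1 \<noteq> 0" by blast
  define u where "u = A v1"
  obtain c where c: "B v1 = c *s u"
    using parallel_multiple[OF par v1] u_def by blast
  \<comment> \<open>Subtracting a multiple of \<open>A\<close> keeps the rows parallel and makes the
    second row vanish at \<open>v1\<close>.\<close>
  define D where "D v = B v - c *s A v" for v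
  have Av: "A (x + y) = A x + A y" "A (r *s x) = r *s A x" for x y r
    using A by (simp_all add: linear_vec_iff)
  have Dv: "D (x + y) = D x + D y" "D (r *s x) = r *s D x" for x y r
    using A B by (simp_all add: D_def linear_vec_iff vector_add_ldistrib
        vector_ssub_ldistrib vector_smult_assoc mult.commute)
  have Dpar: "parallel (A v) (D v)" for v
    using par by (simp add: D_def parallel_diff_scale)
  have D1: "D v1 = 0"
    by (simp add: D_def c u_def)
  \<comment> \<open>Moving from v to v + \<open>v1\<close> adds u to \<open>A v\<close> and leaves
    \<open>D v\<close> alone; the difference of the vanishing minors is the minors of u and
    \<open>D v\<close>.\<close>
  have Du: "parallel u (D v)" for v
  proof -
    have "parallel (A v + u) (D v)"
      using Dpar[of "v + v1"] by (simp add: Av Dv D1 u_def)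
    then show ?thesis
      using Dpar[of v] by (simp add: parallel_def algebra_simps)
  qed
  show thesis
  proof (cases "\<forall>v. D v = 0")
    case True
    then show thesis
      using that[of A 1 c] A by (simp add: D_def)
  next
    case False
    then obtain v2 where v2: "D v2 \<noteq> 0" by blast
    have Au1: "parallel u (A v)" if nz: "D v \<noteq> 0" for v
    proof -
      obtain r where r: "A v = r *s D v"
        using parallel_multiple[OF parallel_sym[THEN iffD1, OF Dpar] nz] .
      then show ?thesis
        using Du[of v] by (simp add: parallel_def algebra_simps)
    qed
    \<comment> \<open>Where \<open>D v\<close> vanishes, adding \<open>v2\<close> leads back to the
      case treated before.\<close>
    have Au: "parallel u (A v)" for v
    proof (cases "D v = 0")
      case True
      then have "parallel u (A v + A v2)"
        using Au1[of "v + v2"] v2 by (simp add: Av Dv)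
      then show ?thesis
        using Au1[OF v2] by (simp add: parallel_def algebra_simps)
    qed (rule Au1)
    obtain i where i: "u $ i \<noteq> 0"
      using v1 by (auto simp: vec_eq_iff u_def)
    have zero: "x = 0" if x: "parallel u x" "x $ i = 0" for x
    proof -
      obtain r where "x = r *s u"
        using parallel_multiple[OF x(1)] v1 u_def by blast
      then show ?thesis
        using x(2) i by simp
    qed
    \<comment> \<open>All values of \<open>A\<close> and \<open>D\<close> lie on the line of u, so
      their coordinate i determines them. Two linear conditions therefore produce a nonzero vector
      killed by both.\<close>
    obtain w where w: "w \<noteq> 0" "A w $ i = 0" "D w $ i = 0"
    proof (rule common_zero[of "[\<lambda>v. A v $ i, \<lambda>v. D v $ i]"])
      show "Vector_Spaces.linear (*s) (*) f"
        if "f \<in> set [\<lambda>v. A v $ i, \<lambda>v. D v $ i]" for f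
        using that by (auto simp: linear_functional_iff Av Dv)
    qed (use n in auto)
    then have "A w = 0" "D w = 0"
      using zero Au Du by auto
    then have "w = 0"
      using ker[of w] by (simp add: D_def)
    with w show thesis by simp
  qed
qed

text \<open>Flattening matrices to vectors indexed by pairs reduces this to an injective
  endomorphism of a coordinate space.\<close>

lemma linear_matrix_inj_imp_surj:
  fixes \<phi> :: "'k::field^'n^'m \<Rightarrow> 'k^'n^'m"
  assumes lin: "Vector_Spaces.linear mat_scale mat_scale \<phi>" and inj: "inj \<phi>"
  shows "surj \<phi>"
proof -
  define flat :: "'k^'n^'m \<Rightarrow> 'k^('m \<times> 'n)" where "flat X = (\<chi> p. X $ fst p $ snd p)" for X
  define unflat :: "'k^('m \<times> 'n) \<Rightarrow> 'k^'n^'m" where "unflat x = (\<chi> i j. x $ (i, j))" for x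
  have flat_unflat [simp]: "flat (unflat x) = x" "unflat (flat X) = X" for x X
    by (simp_all add: flat_def unflat_def vec_eq_iff)
  have \<phi>: "\<phi> (X + Y) = \<phi> X + \<phi> Y" "\<phi> (mat_scale c X) = mat_scale c (\<phi> X)" for X Y c
    using lin by (auto simp: Vector_Spaces.linear_iff)
  have fl: "flat (X + Y) = flat X + flat Y" "flat (mat_scale c X) = c *s flat X" for X Y c
    by (simp_all add: flat_def mat_scale_def map_matrix_def vec_eq_iff)
  have un: "unflat (x + y) = unflat x + unflat y" "unflat (c *s x) = mat_scale c (unflat x)" for x y c
    by (simp_all add: unflat_def mat_scale_def map_matrix_def vec_eq_iff)
  have "Vector_Spaces.linear (*s) (*s) (flat \<circ> \<phi> \<circ> unflat)"
    by (simp add: linear_vec_iff fl un \<phi>)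
  moreover have "inj (flat \<circ> \<phi> \<circ> unflat)"
    by (intro inj_compose inj) (metis flat_unflat injI)+
  ultimately have "surj (flat \<circ> \<phi> \<circ> unflat)"
    by (rule vec.linear_inj_imp_surj)
  have "\<exists>X. Y = \<phi> X" for Y
  proof -
    obtain x where "flat Y = flat (\<phi> (unflat x))"
      using surjD[OF \<open>surj (flat \<circ> \<phi> \<circ> unflat)\<close>, of "flat Y"] by auto
    then have "unflat (flat Y) = unflat (flat (\<phi> (unflat x)))"
      by simp
    then show ?thesis
      by auto
  qed
  then show ?thesis
    by (auto simp: surj_def)
qed

section \<open>Nondegenerate symmetric bilinear forms\<close>

lemma gram_form_add_left: "gram_form S (x + y) z = gram_form S x z + gram_form S y z"
  and gram_form_scale_left: "gram_form S (c *s x) z = c * gram_form S x z"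
  by (simp_all add: gram_form_def distrib_right sum.distrib sum_distrib_left mult.assoc)

lemma gram_form_add_right: "gram_form S x (y + z) = gram_form S x y + gram_form S x z"
  by (simp add: gram_form_def matrix_vector_right_distrib distrib_left sum.distrib)

lemma gram_form_scale_right:
  fixes S :: "'k::field^'n^'n"
  shows "gram_form S x (c *s y) = c * gram_form S x y"
  by (simp add: gram_form_def vec.scale sum_distrib_left ac_simps)

lemma gram_form_0 [simp]: "gram_form S 0 x = 0" "gram_form S x 0 = 0"
  by (simp_all add: gram_form_def matrix_vector_mult_def)

lemma gram_form_diff_left: "gram_form S (x - y) z = gram_form S x z - gram_form S y z"
  using gram_form_add_left[of S "x - y" y z] by simp

lemma gram_form_diff_right: "gram_form S x (y - z) = gram_form S x y - gram_form S x z"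
  using gram_form_add_right[of S x "y - z" z] by simp

lemma gram_form_minus: "gram_form S (- x) y = - gram_form S x y" "gram_form S x (- y) = - gram_form S x y"
  using gram_form_diff_left[of S 0 x y] gram_form_diff_right[of S x 0 y] by simp_all

lemmas gram_form_bilinear =
  gram_form_add_left gram_form_add_right gram_form_scale_left gram_form_scale_right
  gram_form_diff_left gram_form_diff_right

lemma gram_form_axis_left: "gram_form S (axis i 1) y = (S *v y) $ i"
  by (simp add: gram_form_def axis_def if_distrib[of "\<lambda>c. c * _"] cong: if_cong)

lemma gram_form_axis: "gram_form S (axis i 1) (axis j 1) = S $ i $ j"
  unfolding gram_form_axis_left
  by (simp add: matrix_vector_mult_def axis_def if_distrib[of "(*) _"] cong: if_cong)

lemma gram_form_commute:
  assumes "transpose S = S"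
  shows "gram_form S x y = gram_form S y x"
proof -
  have S: "S $ i $ j = S $ j $ i" for i j
    using assms by (metis (no_types) transpose_def vec_lambda_beta)
  have "gram_form S x y = (\<Sum>i\<in>UNIV. \<Sum>j\<in>UNIV. x $ i * (S $ i $ j * y $ j))"
    by (simp add: gram_form_def matrix_vector_mult_def sum_distrib_left)
  also have "\<dots> = (\<Sum>j\<in>UNIV. \<Sum>i\<in>UNIV. x $ i * (S $ i $ j * y $ j))"
    by (rule sum.swap)
  also have "\<dots> = gram_form S y x"
    by (simp add: gram_form_def matrix_vector_mult_def sum_distrib_left S ac_simps)
  finally show ?thesis .
qed

lemma gram_form_congruence:
  "gram_form (transpose g ** S ** g) x y = gram_form S (g *v x) (g *v y)"
proof -
  have *: "(transpose g *v u) $ i = (\<Sum>j\<in>UNIV. g $ j $ i * u $ j)" for u i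
    by (simp add: matrix_vector_mult_def transpose_def)
  have "gram_form (transpose g ** S ** g) x y = (\<Sum>i\<in>UNIV. \<Sum>j\<in>UNIV. x $ i * (g $ j $ i * (S *v (g *v y)) $ j))"
    by (simp add: gram_form_def matrix_vector_mul_assoc[symmetric] sum_distrib_left *
        del: transpose_matrix_vector)
  also have "\<dots> = (\<Sum>j\<in>UNIV. \<Sum>i\<in>UNIV. x $ i * (g $ j $ i * (S *v (g *v y)) $ j))"
    by (rule sum.swap)
  also have "\<dots> = gram_form S (g *v x) (g *v y)"
    by (simp add: gram_form_def matrix_vector_mult_def[of g x] sum_distrib_left sum_distrib_right ac_simps)
  finally show ?thesis .
qed

text \<open>For fixed x the determinant is a quadratic form in the second argument; this isolates
  its polar form, so that relations between such determinants pass to polar forms.\<close>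

lemma gram_det_polarisation:
  assumes "transpose S = S"
  shows "gram_form S x x * gram_form S (y + z) (y + z) - gram_form S x (y + z) ^ 2
    = (gram_form S x x * gram_form S y y - gram_form S x y ^ 2)
    + (gram_form S x x * gram_form S z z - gram_form S x z ^ 2)
    + 2 * (gram_form S x x * gram_form S y z - gram_form S x y * gram_form S x z)"
  by (simp add: gram_form_bilinear gram_form_commute[OF assms] power2_eq_square algebra_simps)

locale nondegenerate_form =
  fixes S :: "'k::field^'n^'n"
  assumes sym: "transpose S = S" and inv: "invertible S"
    and two: "(2 :: 'k) \<noteq> 0"
begin

abbreviation b where "b \<equiv> gram_form S"

lemmas b_simps = gram_form_bilinear gram_form_commute[OF sym]

lemma nondegenerate:
  assumes "\<And>y. b y x = 0"
  shows "x = 0"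
proof -
  have "S *v x = 0"
    using assms gram_form_axis_left[of S _ x] by (simp add: vec_eq_iff)
  then show ?thesis
    using inv invertible_left_inverse matrix_left_invertible_ker by blast
qed

lemma dual_vector:
  assumes "\<not> parallel x y"
  obtains z where "b x z = 1" "b y z = 0"
proof -
  obtain i j where ij: "x $ i * y $ j - x $ j * y $ i \<noteq> 0"
    using assms by (auto simp: parallel_def)
  let ?D = "x $ i * y $ j - x $ j * y $ i"
  obtain T where T: "S ** T = mat 1"
    using inv by (auto simp: invertible_def)
  \<comment> \<open>By Cramer's rule: \<open>S *v z\<close> is chosen so that \<open>b v z\<close>
    is the minor of v and y at i, j divided by that of x and y.\<close>
  define z where "z = T *v ((y $ j / ?D) *s axis i 1 - (y $ i / ?D) *s axis j 1)"
  have Sz: "S *v z = (y $ j / ?D) *s axis i 1 - (y $ i / ?D) *s axis j 1"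
    by (simp add: z_def matrix_vector_mul_assoc T)
  have z: "b v z = (v $ i * y $ j - v $ j * y $ i) / ?D" for v
    unfolding gram_form_def Sz
    by (simp add: axis_def right_diff_distrib sum_subtractf diff_divide_distrib
        if_distrib[of "(*) _"] cong: if_cong)
  have "b x z = 1"
    using ij by (simp add: z)
  moreover have "b y z = 0"
    by (simp add: z)
  ultimately show thesis ..
qed

section \<open>The discriminant of a pair of vectors\<close>

definition disc where "disc x y = b x x * b y y - b x y ^ 2"

lemma gram_det_disc: "gram_det S X = disc (X $ 1) (X $ 2)"
  by (simp add: gram_det_def disc_def power2_eq_square gram_form_commute[OF sym])

text \<open>If \<open>disc x w\<close> vanished for all x, its polar form would too. A nonzero x
  orthogonal to w and a y not orthogonal to x then give \<open>b w w = 0\<close>, whence w is in the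
  radical.\<close>

lemma disc_nonzero:
  assumes n: "CARD('n) \<ge> 2" and w: "w \<noteq> 0"
  obtains x where "disc x w \<noteq> 0"
proof -
  have "w = 0" if disc: "\<And>x. disc x w = 0"
  proof -
    have "2 * (b x y * b w w) = 2 * (b x w * b y w)" for x y
      using disc[of "x + y"] disc[of x] disc[of y]
      by (simp add: disc_def b_simps power2_eq_square algebra_simps)
    then have polar: "b x y * b w w = b x w * b y w" for x y
      using two by simp
    obtain x where x: "x \<noteq> 0" "b x w = 0"
      by (rule common_zero[of "[\<lambda>x. b x w]"])
        (use n in \<open>auto simp: linear_functional_iff gram_form_bilinear\<close>)
    obtain y where "b y x \<noteq> 0"
      using nondegenerate x(1) by blast
    then have "b w w = 0"
      using polar[of y x] x(2) by simp
    then have "b x w = 0" for x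
      using polar[of x x] by simp
    then show ?thesis
      by (rule nondegenerate)
  qed
  with w that show thesis by blast
qed

text \<open>For two vectors \<open>x1\<close>, \<open>x2\<close>, polarising in the second argument at a vector orthogonal to
  both with respect to both forms yields the same ratio of the quadratic forms at \<open>x1\<close> and \<open>x2\<close>;
  such a vector exists because four linear conditions do not exhaust a space of dimension five.\<close>

lemma proportional_of_disc_proportional:
  fixes S' :: "'k^'n^'n"
  assumes sym': "transpose S' = S'" and n: "CARD('n) \<ge> 5"
    and d: "\<And>x y. d * (gram_form S' x x * gram_form S' y y - gram_form S' x y ^ 2) = disc x y"
  obtains \<beta> where "S = mat_scale \<beta> S'" "\<beta> \<noteq> 0" "d = \<beta> ^ 2"
proof -
  let ?b' = "gram_form S'"
  note simps = b_simps gram_form_commute[OF sym']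
  have "2 * (d * (?b' x x * ?b' y z - ?b' x y * ?b' x z)) = 2 * (b x x * b y z - b x y * b x z)"
    for x y z
    using d[of x "y + z"]
    unfolding disc_def gram_det_polarisation[OF sym] gram_det_polarisation[OF sym'] distrib_left
    unfolding d disc_def by (simp only: add_left_cancel) (simp only: mult.left_commute)
  then have polar: "d * (?b' x x * ?b' y z - ?b' x y * ?b' x z) = b x x * b y z - b x y * b x z"
    for x y z
    by (rule mult_left_cancel[OF two, THEN iffD1])
  have ratio: "\<exists>\<beta>. b x1 x1 = \<beta> * ?b' x1 x1 \<and> b x2 x2 = \<beta> * ?b' x2 x2" for x1 x2
  proof -
    obtain y where y: "y \<noteq> 0" "b x1 y = 0" "b x2 y = 0" "?b' x1 y = 0" "?b' x2 y = 0"
      by (rule common_zero[of "[b x1, b x2, ?b' x1, ?b' x2]"])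
        (use n in \<open>auto simp: linear_functional_iff gram_form_bilinear\<close>)
    obtain z where z: "b z y \<noteq> 0"
      using nondegenerate y(1) by blast
    have "b x x = (d * ?b' z y / b z y) * ?b' x x" if "x \<in> {x1, x2}" for x
      using polar[of x y z] y that z
      by (auto simp: field_simps gram_form_commute[OF sym] gram_form_commute[OF sym'])
    then show ?thesis by blast
  qed
  obtain w :: "'k^'n" where "w \<noteq> 0"
    using zero_neq_one axis_eq_0_iff by metis
  then obtain x y where xy: "disc x y \<noteq> 0"
    using disc_nonzero n by (metis le_trans numeral_le_iff semiring_norm(68,69,71,72,76,78))
  have "\<exists>x. b x x \<noteq> 0"
  proof (rule ccontr)
    assume "\<not> ?thesis"
    then have q: "b x x = 0" for x by simp
    have "2 * b x y = 0"
      using q[of "x + y"] q[of x] q[of y] by (simp add: b_simps)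
    then show False
      using xy two q by (simp add: disc_def)
  qed
  then obtain x0 where x0: "b x0 x0 \<noteq> 0" by blast
  \<comment> \<open>Applying \<open>ratio\<close> to the pair of \<open>x0\<close> and any x shows
    that the ratio at this one anisotropic vector holds at x as well.\<close>
  define \<beta> where "\<beta> = b x0 x0 / ?b' x0 x0"
  have q: "b x x = \<beta> * ?b' x x" for x
    using ratio[of x0 x] x0 by (auto simp: \<beta>_def)
  have "2 * b x y = 2 * (\<beta> * ?b' x y)" for x y
    using q[of "x + y"] q[of x] q[of y] by (simp add: simps algebra_simps)
  then have b: "b x y = \<beta> * ?b' x y" for x y
    using two by simp
  have "S = mat_scale \<beta> S'"
    using b[of "axis _ 1" "axis _ 1"] by (simp add: gram_form_axis vec_eq_iff mat_scale_def map_matrix_def)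
  moreover have "\<beta> \<noteq> 0"
    using b x0 by auto
  moreover have "d = \<beta> ^ 2"
  proof -
    have "disc x y = \<beta> ^ 2 * (?b' x x * ?b' y y - ?b' x y ^ 2)"
      by (simp add: disc_def b power2_eq_square algebra_simps)
    then show ?thesis
      using d[of x y] xy by (metis mult_cancel_right mult_zero_right)
  qed
  ultimately show thesis ..
qed

section \<open>Gradient and Hessian of f, and their values at rank-one matrices\<close>

definition grad :: "'k^'n^2 \<Rightarrow> 'k^'n^2 \<Rightarrow> 'k"
  where "grad X Z = b (X $ 2) (X $ 2) * b (X $ 1) (Z $ 1) + b (X $ 1) (X $ 1) * b (X $ 2) (Z $ 2)
    - b (X $ 1) (X $ 2) * (b (X $ 1) (Z $ 2) + b (X $ 2) (Z $ 1))"

definition hess :: "'k^'n^2 \<Rightarrow> 'k^'n^2 \<Rightarrow> 'k"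
  where "hess X Z = b (X $ 1) (X $ 1) * b (Z $ 2) (Z $ 2) + b (Z $ 1) (Z $ 1) * b (X $ 2) (X $ 2)
    + 4 * b (X $ 1) (Z $ 1) * b (X $ 2) (Z $ 2) - 2 * b (X $ 1) (X $ 2) * b (Z $ 1) (Z $ 2)
    - (b (X $ 1) (Z $ 2) + b (X $ 2) (Z $ 1)) ^ 2"

lemma mat_scale_row [simp]: "mat_scale c X $ i = c *s (X $ i)"
  by (simp add: mat_scale_def map_matrix_def vec_eq_iff)

text \<open>Along X + tZ, f is a quartic in t with linear coefficient \<open>2 * grad X Z\<close>.
  The combination of differences cancels the cubic coefficient, so a linear map preserving the
  values of f preserves the gradient once 24 is invertible.\<close>

lemma grad_eq:
  "24 * grad X Z = 8 * (gram_det S (X + Z) - gram_det S (X - Z))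
    - (gram_det S (X + mat_scale 2 Z) - gram_det S (X - mat_scale 2 Z))"
  by (simp add: gram_det_disc disc_def grad_def b_simps power2_eq_square algebra_simps)

text \<open>\<open>hess X Z\<close> is the coefficient of t^2 in f(X + tZ); the coefficients of t^0
  and t^4 are the values of f at X and Z.\<close>

lemma hess_eq:
  "2 * hess X Z = gram_det S (X + Z) + gram_det S (X - Z) - 2 * gram_det S X - 2 * gram_det S Z"
  by (simp add: gram_det_disc disc_def hess_def b_simps power2_eq_square algebra_simps)

text \<open>Directions dual to one row and orthogonal to the other isolate the single coefficients
  of the gradient.\<close>

lemma grad_zero_cases:
  assumes "\<And>Z. grad X Z = 0" "\<not> parallel (X $ 1) (X $ 2)"
  shows "b (X $ 1) (X $ 1) = 0" "b (X $ 2) (X $ 2) = 0" "b (X $ 1) (X $ 2) = 0"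
proof -
  obtain z where z: "b (X $ 1) z = 1" "b (X $ 2) z = 0"
    using dual_vector assms(2) by blast
  obtain w where w: "b (X $ 2) w = 1" "b (X $ 1) w = 0"
    using dual_vector assms(2) parallel_sym by blast
  show "b (X $ 2) (X $ 2) = 0"
    using assms(1)[of "vector [z, 0]"] z by (simp add: grad_def)
  show "b (X $ 1) (X $ 1) = 0"
    using assms(1)[of "vector [0, w]"] w by (simp add: grad_def)
  show "b (X $ 1) (X $ 2) = 0"
    using assms(1)[of "vector [0, z]"] z by (simp add: grad_def)
qed

definition outer :: "'k^2 \<Rightarrow> 'k^'n \<Rightarrow> 'k^'n^2"
  where "outer a v = (\<chi> i. a $ i *s v)"

lemma outer_row [simp]: "outer a v $ i = a $ i *s v"
  by (simp add: outer_def)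

lemma outer_linear:
  "outer a (v + w) = outer a v + outer a w" "outer a (c *s v) = mat_scale c (outer a v)"
  by (simp_all add: vec_eq_iff algebra_simps)

lemma outer_eq_0_iff: "outer a v = 0 \<longleftrightarrow> a = 0 \<or> v = 0"
  by (auto simp: vec_eq_iff)

lemma grad_outer: "grad (outer a v) Z = 0"
  by (simp add: grad_def b_simps algebra_simps)

text \<open>Only the combination of the rows of Z that annihilates multiples of a enters. This makes
  the Hessian at a rank-one point a quadratic form on a single copy of the vector space.\<close>

lemma hess_outer:
  "hess (outer a v) Z = disc v (a $ 1 *s Z $ 2 - a $ 2 *s Z $ 1)"
  by (simp add: hess_def disc_def b_simps power2_eq_square algebra_simps)

end

section \<open>Preservers\<close>

locale gram_det_preserver = nondegenerate_form S for S :: "'k::field^'n^'n" +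
  fixes \<phi> :: "'k^'n^2 \<Rightarrow> 'k^'n^2"
  assumes three: "(3 :: 'k) \<noteq> 0"
    and n: "CARD('n) \<ge> 5"
    and lin: "Vector_Spaces.linear mat_scale mat_scale \<phi>"
    and preserves: "\<And>X. gram_det S (\<phi> X) = gram_det S X"
begin

lemma \<phi>_linear: "\<phi> (X + Y) = \<phi> X + \<phi> Y" "\<phi> (mat_scale c X) = mat_scale c (\<phi> X)"
  using lin by (auto simp: Vector_Spaces.linear_iff)

lemma \<phi>_0: "\<phi> 0 = 0"
  using \<phi>_linear(1)[of 0 0] by simp

lemma \<phi>_diff: "\<phi> (X - Y) = \<phi> X - \<phi> Y"
  using \<phi>_linear(1)[of "X - Y" Y] by simp

lemma grad_preserved: "grad (\<phi> X) (\<phi> Z) = grad X Z"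
proof -
  have "24 * grad (\<phi> X) (\<phi> Z) = 24 * grad X Z"
    unfolding grad_eq by (simp add: preserves flip: \<phi>_linear \<phi>_diff)
  moreover have "(24 :: 'k) = 2 * 2 * 2 * 3"
    by simp
  ultimately show ?thesis
    using two three by (metis mult_cancel_left mult_eq_0_iff)
qed

lemma hess_preserved: "hess (\<phi> X) (\<phi> Z) = hess X Z"
proof -
  have "2 * hess (\<phi> X) (\<phi> Z) = 2 * hess X Z"
    unfolding hess_eq by (simp add: preserves flip: \<phi>_linear \<phi>_diff)
  then show ?thesis
    using two by simp
qed

text \<open>A kernel vector Z makes \<open>hess X Z\<close> vanish for every X. Matrices X with one
  nonzero row turn this into \<open>disc x\<close> vanishing at each row of Z for all x.\<close>

lemma \<phi>_eq_0D:
  assumes "\<phi> Z = 0"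
  shows "Z = 0"
proof -
  have H: "hess X Z = 0" for X
    using hess_preserved[of X Z] assms by (simp add: hess_def)
  have "disc x (Z $ 2) = 0" for x
    using H[of "outer (axis 1 1) x"] by (simp add: hess_outer axis_def)
  moreover have "disc x (Z $ 1) = 0" for x
    using H[of "outer (axis 2 1) x"] by (simp add: hess_outer axis_def disc_def gram_form_minus)
  ultimately have "Z $ 1 = 0" "Z $ 2 = 0"
    using disc_nonzero n by (metis le_trans numeral_le_iff semiring_norm(68,69,71,72,76,78))+
  then show ?thesis
    by (simp add: vec_eq_iff[of Z] forall_2)
qed

lemma inj: "inj \<phi>"
proof (rule injI)
  fix X Y assume "\<phi> X = \<phi> Y"
  then show "X = Y"
    using \<phi>_eq_0D[of "X - Y"] by (simp add: \<phi>_diff)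
qed

lemma surj: "surj \<phi>"
  using lin inj by (rule linear_matrix_inj_imp_surj)

text \<open>At a singular point of rank two the Hessian is \<open>4\<alpha>\<beta> - \<gamma>\<^sup>2\<close> with independent linear forms
  \<open>\<alpha>\<close>, \<open>\<beta>\<close>, \<open>\<gamma>\<close>, hence of rank 3; at \<open>a \<otimes> v\<close> it has rank \<open>1\<close> or \<open>n - 1 \<ge> 4\<close>.\<close>

lemma parallel_image_outer: "parallel (\<phi> (outer a v) $ 1) (\<phi> (outer a v) $ 2)"
proof (rule ccontr)
  define X where "X = outer a v"
  define x y where "x = \<phi> X $ 1" and "y = \<phi> X $ 2"
  assume "\<not> ?thesis"
  then have np: "\<not> parallel x y"
    by (simp add: x_def y_def X_def)
  then have "\<phi> X \<noteq> 0"
    by (auto simp: x_def y_def parallel_def)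
  then have nz: "a \<noteq> 0" "v \<noteq> 0"
    using \<phi>_0 outer_eq_0_iff X_def by metis+
  \<comment> \<open>By surjectivity every direction is an image, so \<open>\<phi> X\<close> is again
    a singular point.\<close>
  have "grad (\<phi> X) Z = 0" for Z
    using surj grad_preserved grad_outer unfolding X_def by (metis surjD)
  from grad_zero_cases[OF this] np have iso: "b x x = 0" "b y y = 0" "b x y = 0"
    unfolding x_def y_def by blast+
  define u where "u Z = a $ 1 *s Z $ 2 - a $ 2 *s Z $ 1" for Z :: "'k^'n^2"
  have H: "disc v (u Z) = 4 * b x (\<phi> Z $ 1) * b y (\<phi> Z $ 2) - (b x (\<phi> Z $ 2) + b y (\<phi> Z $ 1)) ^ 2" for Z
  proof -
    have "disc v (u Z) = hess (\<phi> X) (\<phi> Z)"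
      by (simp add: hess_preserved X_def hess_outer u_def)
    then show ?thesis
      using iso by (simp add: hess_def x_def y_def)
  qed
  show False
  proof (cases "b v v = 0")
    case True
    \<comment> \<open>Here the Hessian is minus the square of a linear form, so its zeros are closed
      under addition. \<open>Z\<close> and \<open>W\<close> are zeros, but at their sum the other
      expression takes the value 4.\<close>
    obtain z where z: "b x z = 1" "b y z = 0"
      using dual_vector np by blast
    obtain w where w: "b y w = 1" "b x w = 0"
      using dual_vector np parallel_sym by blast
    obtain Z W where Z: "\<phi> Z = vector [z, 0]" and W: "\<phi> W = vector [0, w]"
      using surj by (metis surjD)
    have "b v (u Z) = 0" "b v (u W) = 0"
      using H[of Z] H[of W] True z w by (simp_all add: Z W disc_def)
    moreover have "u (Z + W) = u Z + u W"
      by (simp add: u_def algebra_simps)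
    ultimately have "(4 :: 'k) = 0"
      using H[of "Z + W"] True z w by (simp add: Z W disc_def \<phi>_linear gram_form_bilinear)
    moreover have "(4 :: 'k) = 2 * 2"
      by simp
    ultimately show False
      using two by (metis mult_eq_0_iff)
  next
    case False
    \<comment> \<open>Completing a to a basis of determinant 1 makes \<open>outer c\<close> a right
      inverse of \<open>u\<close>.\<close>
    obtain c :: "'k^2" where c: "a $ 1 * c $ 2 - a $ 2 * c $ 1 = 1"
    proof (cases "a $ 1 = 0")
      case True
      then have "a $ 2 \<noteq> 0"
        using nz(1) by (simp add: vec_eq_iff forall_2)
      with True that[of "vector [- 1 / a $ 2, 0]"] show thesis by simp
    next
      case False
      with that[of "vector [0, 1 / a $ 1]"] show thesis by simp
    qed
    have u_outer: "u (outer c w) = w" for w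
    proof -
      have "u (outer c w) = (a $ 1 * c $ 2 - a $ 2 * c $ 1) *s w"
        by (simp add: u_def vec_eq_iff algebra_simps)
      then show ?thesis by (simp add: c)
    qed
    \<comment> \<open>Orthogonality to v and the three linear forms at the image: four conditions in
      dimension at least five.\<close>
    define L where "L = [b v, \<lambda>w. b x (\<phi> (outer c w) $ 1), \<lambda>w. b y (\<phi> (outer c w) $ 2),
      \<lambda>w. b x (\<phi> (outer c w) $ 2) + b y (\<phi> (outer c w) $ 1)]"
    obtain w where w: "w \<noteq> 0" "\<And>f. f \<in> set L \<Longrightarrow> f w = 0"
      by (rule common_zero[of L])
        (use n in \<open>auto simp: L_def linear_functional_iff gram_form_bilinear outer_linear \<phi>_linear algebra_simps\<close>)
    have vw: "b v w = 0"
      and \<alpha>: "b x (\<phi> (outer c w) $ 1) = 0" and \<beta>: "b y (\<phi> (outer c w) $ 2) = 0"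
      and \<gamma>: "b x (\<phi> (outer c w) $ 2) + b y (\<phi> (outer c w) $ 1) = 0"
      using w(2) by (auto simp: L_def)
    have \<gamma>': "b y (\<phi> (outer c w) $ 1) = - b x (\<phi> (outer c w) $ 2)"
      using \<gamma> by (simp add: eq_neg_iff_add_eq_0 add.commute)
    \<comment> \<open>The three linear forms vanish at w, so translation by w leaves the Hessian
      unchanged. As w is orthogonal to v and \<open>b v v\<close> is nonzero, this puts w in the
      radical.\<close>
    have disc_shift: "disc v (z + w) = disc v z" for z
      using H[of "outer c (z + w)"] H[of "outer c z"] unfolding u_outer
      by (simp only: outer_linear \<phi>_linear vector_add_component gram_form_add_right \<alpha> \<beta> \<gamma>') simp
    have "b v v * (b z w + b z w + b w w) = 0" for z
      using disc_shift[of z] vw by (simp add: disc_def b_simps algebra_simps)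
    then have z: "b z w + b z w + b w w = 0" for z
      using False by simp
    then have "b w w = 0"
      using z[of 0] by simp
    then have "2 * b z w = 0" for z
      using z[of z] by simp
    then have "b z w = 0" for z
      using two by simp
    then have "w = 0"
      by (rule nondegenerate)
    with w(1) show False by simp
  qed
qed

section \<open>Tensor decomposition of a preserver\<close>

lemma image_outer:
  assumes "a \<noteq> 0"
  obtains p1 p2 G where "Vector_Spaces.linear (*s) (*s) G"
    "\<And>v. \<phi> (outer a v) $ 1 = p1 *s G v" "\<And>v. \<phi> (outer a v) $ 2 = p2 *s G v"
proof (rule parallel_pencil)
  show "Vector_Spaces.linear (*s) (*s) (\<lambda>v. \<phi> (outer a v) $ 1)"
    "Vector_Spaces.linear (*s) (*s) (\<lambda>v. \<phi> (outer a v) $ 2)"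
    by (simp_all add: linear_vec_iff outer_linear \<phi>_linear)
  show "parallel (\<phi> (outer a v) $ 1) (\<phi> (outer a v) $ 2)" for v
    by (rule parallel_image_outer)
  \<comment> \<open>Both \<open>outer a\<close>, as a is nonzero, and \<open>\<phi>\<close> are
    injective.\<close>
  show "v = 0" if "\<phi> (outer a v) $ 1 = 0" "\<phi> (outer a v) $ 2 = 0" for v
  proof -
    have "\<phi> (outer a v) = 0"
      using that by (simp add: vec_eq_iff[of "\<phi> _"] forall_2)
    then have "outer a v = 0"
      by (rule \<phi>_eq_0D)
    then show ?thesis
      using assms by (simp add: outer_eq_0_iff)
  qed
qed (use n that in auto)

lemma gram_det_nonzero:
  obtains X where "gram_det S X \<noteq> 0"
proof -
  obtain w :: "'k^'n" where "w \<noteq> 0"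
    using zero_neq_one axis_eq_0_iff by metis
  then obtain x where "disc x w \<noteq> 0"
    using disc_nonzero n by (metis le_trans numeral_le_iff semiring_norm(68,69,71,72,76,78))
  then show thesis
    using that[of "vector [x, w]"] by (simp add: gram_det_disc)
qed

text \<open>The two matrix rows contribute p \<otimes> G1 and q \<otimes> G2. Rank one is also
  preserved on their sum, which makes G1 and G2 parallel when p and q are independent; the pencil
  argument, used a second time, gives a common G.\<close>

lemma row_form:
  obtains g :: "'k^2^2" and G where "Vector_Spaces.linear (*s) (*s) G"
    "\<And>X i. \<phi> X $ i = g $ i $ 1 *s G (X $ 1) + g $ i $ 2 *s G (X $ 2)"
proof -
  define e where "e i = (axis i 1 :: 'k^2)" for i
  have e: "e i \<noteq> 0" for i
    by (simp add: e_def axis_eq_0_iff)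
  obtain p1 p2 G1 where G1: "Vector_Spaces.linear (*s) (*s) G1"
    "\<And>v. \<phi> (outer (e 1) v) $ 1 = p1 *s G1 v" "\<And>v. \<phi> (outer (e 1) v) $ 2 = p2 *s G1 v"
    by (rule image_outer[OF e[of 1]], rule that)
  obtain q1 q2 G2 where G2: "Vector_Spaces.linear (*s) (*s) G2"
    "\<And>v. \<phi> (outer (e 2) v) $ 1 = q1 *s G2 v" "\<And>v. \<phi> (outer (e 2) v) $ 2 = q2 *s G2 v"
    by (rule image_outer[OF e[of 2]], rule that)
  have X: "X = outer (e 1) (X $ 1) + outer (e 2) (X $ 2)" for X :: "'k^'n^2"
    by (simp add: vec_eq_iff[of X] forall_2 e_def axis_def)
  have \<phi>_split: "\<phi> X = \<phi> (outer (e 1) (X $ 1)) + \<phi> (outer (e 2) (X $ 2))" for X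
    by (rule trans[OF arg_cong[OF X, of \<phi>] \<phi>_linear(1)])
  have rows: "\<phi> X $ 1 = p1 *s G1 (X $ 1) + q1 *s G2 (X $ 2)"
    "\<phi> X $ 2 = p2 *s G1 (X $ 1) + q2 *s G2 (X $ 2)" for X
    unfolding \<phi>_split[of X] vector_add_component G1 G2 by (rule refl)+
  \<comment> \<open>If p and q were dependent, all images would have rank at most one and f would
    vanish identically.\<close>
  have det: "p1 * q2 - p2 * q1 \<noteq> 0"
  proof
    assume 0: "p1 * q2 - p2 * q1 = 0"
    have "gram_det S X = (p1 * q2 - p2 * q1) ^ 2 * disc (G1 (X $ 1)) (G2 (X $ 2))" for X
      unfolding preserves[symmetric, of X] unfolding gram_det_disc rows
      by (simp add: disc_def b_simps power2_eq_square algebra_simps)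
    then have "gram_det S X = 0" for X
      using 0 by simp
    then show False
      by (meson gram_det_nonzero)
  qed
  obtain s t G where G: "Vector_Spaces.linear (*s) (*s) G" "\<And>v. G1 v = s *s G v" "\<And>v. G2 v = t *s G v"
  proof (rule parallel_pencil[OF G1(1) G2(1)])
    show "parallel (G1 v) (G2 v)" for v
    proof -
      have sum: "outer (e 1 + e 2) v = outer (e 1) v + outer (e 2) v"
        by (simp add: vec_eq_iff algebra_simps)
      have "parallel (p1 *s G1 v + q1 *s G2 v) (p2 *s G1 v + q2 *s G2 v)"
        using parallel_image_outer[of "e 1 + e 2" v]
        by (simp only: sum \<phi>_linear vector_add_component G1 G2)
      then have eq: "(p1 * G1 v $ i + q1 * G2 v $ i) * (p2 * G1 v $ j + q2 * G2 v $ j)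
          = (p1 * G1 v $ j + q1 * G2 v $ j) * (p2 * G1 v $ i + q2 * G2 v $ i)" for i j
        by (simp add: parallel_def)
      \<comment> \<open>The minors of the two image rows are those of \<open>G1 v\<close> and
        \<open>G2 v\<close> times the determinant of p and q.\<close>
      have "(p1 * q2 - p2 * q1) * (G1 v $ i * G2 v $ j) = (p1 * q2 - p2 * q1) * (G1 v $ j * G2 v $ i)"
        for i j
        using eq[of i j] by (simp add: algebra_simps)
      then show ?thesis
        using det by (simp add: parallel_def)
    qed
    show "v = 0" if "G1 v = 0" "G2 v = 0" for v
    proof -
      have "\<phi> (outer (e 1) v) = 0"
        using that by (simp add: vec_eq_iff[of "\<phi> _"] forall_2 G1(2,3))
      then have "outer (e 1) v = 0"
        by (rule \<phi>_eq_0D)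
      then show ?thesis
        using e by (simp add: outer_eq_0_iff)
    qed
  qed (use n in auto)
  \<comment> \<open>The factors s and t of \<open>G1\<close> and \<open>G2\<close> are absorbed into
    the columns of the coefficient matrix.\<close>
  show thesis
  proof (rule that[OF G(1), of "vector [vector [p1 * s, q1 * t], vector [p2 * s, q2 * t]]"])
    fix X and i :: 2
    have "i = 1 \<or> i = 2"
      by (rule exhaust_2)
    then show "\<phi> X $ i = (vector [vector [p1 * s, q1 * t], vector [p2 * s, q2 * t]] :: 'k^2^2) $ i $ 1 *s G (X $ 1)
        + (vector [vector [p1 * s, q1 * t], vector [p2 * s, q2 * t]] :: 'k^2^2) $ i $ 2 *s G (X $ 2)"
      by (auto simp: rows G vector_smult_assoc)
  qed
qed

lemma tensor_form:
  obtains g1 :: "'k^2^2" and g2 :: "'k^'n^'n"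
  where "invertible g1" "g2 \<in> GO S"
    "det g1 * multiplier S g2 = 1 \<or> det g1 * multiplier S g2 = - 1"
    "\<phi> = (\<lambda>X. g1 ** X ** transpose g2)"
proof -
  obtain g :: "'k^2^2" and G where G: "Vector_Spaces.linear (*s) (*s) G"
    and rows: "\<And>X i. \<phi> X $ i = g $ i $ 1 *s G (X $ 1) + g $ i $ 2 *s G (X $ 2)"
    by (rule row_form, rule that)
  define h where "h = matrix G"
  have h: "h *v x = G x" for x
    using matrix_works[OF G] by (simp add: h_def)
  have \<phi>_eq: "\<phi> = (\<lambda>X. g ** X ** transpose h)"
  proof
    fix X
    have "(g ** X ** transpose h) $ i = h *v ((g ** X) $ i)" for i
      by (simp add: vec_eq_iff matrix_matrix_mult_def[of "g ** X"] matrix_vector_mult_def transpose_def mult.commute)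
    moreover have "(g ** X) $ i = g $ i $ 1 *s X $ 1 + g $ i $ 2 *s X $ 2" for i
      by (simp add: vec_eq_iff matrix_matrix_mult_def sum_2)
    ultimately show "\<phi> X = g ** X ** transpose h"
      by (simp add: vec_eq_iff[of "\<phi> X"] rows vec.add vec.scale h)
  qed
  \<comment> \<open>With \<open>\<phi>\<close> equal to X \<mapsto> g X h^t, preservation compares
    the discriminants of S and of its pullback along h, up to the factor \<open>det g ^ 2\<close>.
    Hence S = \<beta> S' with \<beta>^2 = det(g)^2; h has multiplier 1/\<beta>, and the sign of the
    square root is the final sign.\<close>
  define S' where "S' = transpose h ** S ** h"
  have S': "gram_form S' x y = b (G x) (G y)" for x y
    by (simp add: S'_def gram_form_congruence h)
  have sym': "transpose S' = S'"
    by (simp add: S'_def matrix_transpose_mul sym matrix_mul_assoc)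
  have d: "det g ^ 2 * (gram_form S' x x * gram_form S' y y - gram_form S' x y ^ 2) = disc x y" for x y
  proof -
    have "disc x y = gram_det S (\<phi> (vector [x, y]))"
      by (simp only: preserves) (simp add: gram_det_disc)
    then show ?thesis
      by (simp add: gram_det_disc rows S' det_2 disc_def b_simps power2_eq_square algebra_simps)
  qed
  obtain \<beta> where \<beta>: "S = mat_scale \<beta> S'" "\<beta> \<noteq> 0" "det g ^ 2 = \<beta> ^ 2"
    using proportional_of_disc_proportional[OF sym' n d] .
  have S'_eq: "transpose h ** S ** h = mat_scale (1 / \<beta>) S"
    using \<beta>(2) by (subst (2) \<beta>(1)) (simp add: S'_def mat_scale_def map_matrix_def vec_eq_iff)
  \<comment> \<open>A kernel vector of h lies in the radical of \<open>S'\<close>, hence in that of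
    S.\<close>
  have "v = 0" if "h *v v = 0" for v
  proof -
    have "b x v = 0" for x
    proof -
      have "gram_form S' x v = 0"
        using that by (simp add: S' flip: h)
      then show ?thesis
        by (subst \<beta>(1)) (simp add: gram_form_def mat_scale_def map_matrix_def matrix_vector_mult_def
            mult.assoc flip: sum_distrib_left, simp add: mult.left_commute[of _ \<beta>] flip: sum_distrib_left)
    qed
    then show ?thesis
      by (rule nondegenerate)
  qed
  then have "invertible h"
    using invertible_left_inverse matrix_left_invertible_ker by blast
  then have GO: "h \<in> GO S"
    using S'_eq \<beta>(2) unfolding GO_def dvd_field_iff by (intro CollectI conjI exI[of _ "1 / \<beta>"]) auto
  have mult: "multiplier S h = 1 / \<beta>"
    using inv \<beta>(2) S'_eq by (intro multiplier_eqI) auto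
  have det: "det g = \<beta> \<or> det g = - \<beta>"
    using \<beta>(3) by (simp add: power2_eq_iff)
  then have "invertible g"
    using \<beta>(2) by (auto simp: invertible_det_nz)
  moreover have "det g * multiplier S h = 1 \<or> det g * multiplier S h = - 1"
    using det \<beta>(2) by (auto simp: mult)
  ultimately show thesis
    using that GO \<phi>_eq by blast
qed

end

theorem corollary8p11:
  fixes S :: "'k::field^'n^'n"
    and \<phi> :: "'k^'n^2 \<Rightarrow> 'k^'n^2"
  assumes "CHAR('k) \<noteq> 2" and "CHAR('k) \<noteq> 3"
    and "CARD('n) \<ge> 5"
    and "split_gram_matrix S"
    and "Vector_Spaces.linear mat_scale mat_scale \<phi>"
    and "preserves_poly \<phi> (gram_det_poly S)"
  shows "\<exists>(g1 :: 'k^2^2) (g2 :: 'k^'n^'n).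
    invertible g1 \<and> g2 \<in> GO S \<and>
    (det g1 * multiplier S g2 = 1 \<or> det g1 * multiplier S g2 = - 1) \<and>
    \<phi> = (\<lambda>X. g1 ** X ** transpose g2)"
proof -
  \<comment> \<open>The characteristic would divide the prime p without equalling it, hence be 1,
    which is impossible in a field.\<close>
  have char: "of_nat p \<noteq> (0 :: 'k)" if "prime p" "CHAR('k) \<noteq> p" for p
  proof
    assume "of_nat p = (0 :: 'k)"
    then have "CHAR('k) dvd p"
      by (simp add: of_nat_eq_0_iff_char_dvd)
    then have "CHAR('k) = 1"
      using that by (metis prime_nat_iff)
    then show False
      by simp
  qed
  interpret gram_det_preserver S \<phi>
  proof (intro gram_det_preserver.intro nondegenerate_form.intro gram_det_preserver_axioms.intro)
    show "(2 :: 'k) \<noteq> 0" "(3 :: 'k) \<noteq> 0"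
      using char[of 2] char[of 3] assms(1,2) by auto
    show "gram_det S (\<phi> X) = gram_det S X" for X
      using gram_det_preserved assms(5,6) by blast
  qed (use assms in \<open>auto simp: split_gram_matrix_def\<close>)
  show ?thesis
    using tensor_form by blast
qed

end
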